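(* Let $\mu\in\mathbb{R}$, $\beta>0$, let $X_{\mu,\beta}$ be a Gumbel random variable with parameters $\mu$ and $\beta$, and let $Z$ be a standard normal random variable. Then $$P\left\{|X_{\mu,\beta}-E[X_{\mu,\beta}]|\le \sqrt{\mathrm{Var}(X_{\mu,\beta})}\right\}\approx 0.723751>P\{|Z|\le 1\}\approx 0.6827.$$
   Context: A Gumbel random variable with parameters $\mu\in\mathbb{R}$ and $\beta>0$ has cumulative distribution function $P\{X_{\mu,\beta}\le x\}=e^{-e^{-(x-\mu)/\beta}}$, $x\in\mathbb{R}$. The symbol $\approx$ means equality after rounding to the number of decimals displayed. *)

theory Defs
  imports "HOL-Probability.Probability"
begin

definition gumbel_distributed :: "'a measure \<Rightarrow> ('a \<Rightarrow> real) \<Rightarrow> real \<Rightarrow> real \<Rightarrow> bool" where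
  "gumbel_distributed M X \<mu> \<beta> \<longleftrightarrow>
     X \<in> borel_measurable M \<and> (\<forall>x. cdf (distr M borel X) x = exp (- exp (- (x - \<mu>) / \<beta>)))"

text \<open>
  \<open>rounds_to d x a\<close>: the real number \<open>x\<close>, rounded to \<open>d\<close> decimals, is \<open>a\<close>. The library
  function \<^const>\<open>round\<close> rounds to the nearest integer (ties upwards).
\<close>

definition rounds_to :: "nat \<Rightarrow> real \<Rightarrow> real \<Rightarrow> bool" where
  "rounds_to d x a \<longleftrightarrow> real_of_int (round (x * 10 ^ d)) / 10 ^ d = a"

end

theory Submission
  imports Defs "HOL-Real_Asymp.Real_Asymp"
begin

text \<open>
  If \<open>X\<close> is Gumbel distributed, then \<open>U = exp (- (X - \<mu>) / \<beta>)\<close> is exponentially distributed with rate 1,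
  so the moment generating function of \<open>ln U\<close> at \<open>s\<close> is \<open>\<Gamma>(1 + s)\<close>. Differentiating twice at \<open>s = 0\<close>
  gives the moments of \<open>ln U\<close>, hence \<open>X\<close> has mean \<open>\<mu> + \<beta> \<gamma>\<close> and variance \<open>\<beta>\<^sup>2 \<pi>\<^sup>2 / 6\<close>. The probability in
  question is therefore \<open>exp (- exp (- (\<gamma> + s))) - exp (- exp (s - \<gamma>))\<close> with \<open>s = \<pi> / sqrt 6\<close>,
  independently of the parameters. It exceeds 0.723751 by about 2.7e-7, while the rounding interval
  ends 5e-7 above 0.723751, so \<open>\<gamma>\<close> is needed to six or seven digits; these come from an
  Euler-Maclaurin type correction of the harmonic numbers.
\<close>

section \<open>Differentiation under the integral sign\<close>

text \<open>Dominated convergence applied to the difference quotients. The weight \<open>g\<close>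
  makes the result iterable: the derivative is an integral of the same shape with weight
  \<open>g * W\<close>, so a second derivative comes from a second application.\<close>

lemma
  fixes g W :: "'a \<Rightarrow> real"
  assumes meas [measurable]: "g \<in> borel_measurable M" "W \<in> borel_measurable M"
    and int: "\<And>s. \<bar>s\<bar> < a \<Longrightarrow> integrable M (\<lambda>x. g x * exp (s * W x))"
    and s: "\<bar>s\<bar> < a"
  shows integrable_mult_exp_deriv: "integrable M (\<lambda>x. g x * W x * exp (s * W x))"
    and has_real_derivative_integral_mult_exp:
      "((\<lambda>s. \<integral>x. g x * exp (s * W x) \<partial>M) has_real_derivative
          (\<integral>x. g x * W x * exp (s * W x) \<partial>M)) (at s)"
proof -
  \<comment> \<open>A third of the margin, so that \<open>s + 2 * d\<close> and
    \<open>s - 2 * d\<close> stay where integrability is assumed.\<close>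
  define d where "d = (a - \<bar>s\<bar>) / 3"
  have d: "d > 0" "\<bar>s + 2 * d\<bar> < a" "\<bar>s - 2 * d\<bar> < a" and sd: "\<bar>h\<bar> < d \<Longrightarrow> \<bar>s + h\<bar> < a" for h
    using s by (auto simp: d_def abs_if field_simps split: if_splits)
  \<comment> \<open>Dominates the derivative at every point within \<open>d\<close> of
    \<open>s\<close>: one \<open>d\<close> of room absorbs the shift \<open>h\<close>, the other
    absorbs the factor \<open>W x\<close>, at the price of dividing by \<open>d\<close>.\<close>
  define w where "w = (\<lambda>x. (\<bar>g x * exp ((s + 2 * d) * W x)\<bar> + \<bar>g x * exp ((s - 2 * d) * W x)\<bar>) / d)"
  have w: "integrable M w"
    unfolding w_def using d by (intro integrable_divide Bochner_Integration.integrable_add integrable_abs int)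
  have bound: "\<bar>g x * W x * exp ((s + h) * W x)\<bar> \<le> w x" if h: "\<bar>h\<bar> \<le> d" for h x
  proof -
    have "h * W x \<le> d * \<bar>W x\<bar>"
      using mult_right_mono[OF h, of "\<bar>W x\<bar>"] by (simp add: abs_mult[symmetric])
    moreover have "d * \<bar>W x\<bar> \<le> exp (d * \<bar>W x\<bar>)"
      using exp_ge_add_one_self[of "d * \<bar>W x\<bar>"] by linarith
    ultimately have "(d * \<bar>W x\<bar>) * exp (h * W x) \<le> exp (d * \<bar>W x\<bar>) * exp (d * \<bar>W x\<bar>)"
      using d by (intro mult_mono) auto
    also have "\<dots> \<le> exp (2 * d * W x) + exp (- (2 * d) * W x)"
      by (cases "W x \<ge> 0") (auto simp: exp_add[symmetric] algebra_simps)
    finally have "\<bar>g x\<bar> * exp (s * W x) * ((d * \<bar>W x\<bar>) * exp (h * W x))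
        \<le> \<bar>g x\<bar> * exp (s * W x) * (exp (2 * d * W x) + exp (- (2 * d) * W x))"
      by (intro mult_left_mono) auto
    then show ?thesis
      unfolding w_def using d
      by (simp add: abs_mult pos_le_divide_eq algebra_simps exp_add exp_diff)
        (simp add: exp_minus field_simps)
  qed
  show 1: "integrable M (\<lambda>x. g x * W x * exp (s * W x))"
    using bound[of 0] d by (intro Bochner_Integration.integrable_bound[OF w]) (auto intro!: AE_I2 order_trans[OF _ abs_ge_self])
  let ?q = "\<lambda>h x. (g x * exp ((s + h) * W x) - g x * exp (s * W x)) / h"
  have deriv: "((\<lambda>t. g x * exp (t * W x)) has_real_derivative g x * W x * exp (t * W x)) (at t)" for x t
    by (auto intro!: derivative_eq_intros)
  have qbound: "\<bar>?q h x\<bar> \<le> w x" if h: "\<bar>h\<bar> < d" "h \<noteq> 0" for h x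
  proof -
    \<comment> \<open>By the mean value theorem the quotient is a derivative at a point within
      \<open>d\<close> of \<open>s\<close>, so \<open>bound\<close> applies to it.\<close>
    have "\<exists>z. \<bar>z\<bar> \<le> d \<and> g x * exp ((s + h) * W x) - g x * exp (s * W x)
            = h * (g x * W x * exp ((s + z) * W x))"
    proof (cases "h > 0")
      case True
      from MVT2[of s "s + h" "\<lambda>t. g x * exp (t * W x)", OF _ deriv] True
      obtain z where "s < z" "z < s + h"
        "g x * exp ((s + h) * W x) - g x * exp (s * W x) = h * (g x * W x * exp (z * W x))"
        by auto
      with h True show ?thesis by (intro exI[of _ "z - s"]) auto
    next
      case False
      from MVT2[of "s + h" s "\<lambda>t. g x * exp (t * W x)", OF _ deriv] False h
      obtain z where "s + h < z" "z < s"
        "g x * exp (s * W x) - g x * exp ((s + h) * W x) = - h * (g x * W x * exp (z * W x))"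
        by auto
      with h False show ?thesis by (intro exI[of _ "z - s"]) auto
    qed
    then obtain z where "\<bar>z\<bar> \<le> d" and "?q h x = g x * W x * exp ((s + z) * W x)"
      using h by auto
    with bound show ?thesis by metis
  qed
  have lim: "((\<lambda>h. ?q h x) \<longlongrightarrow> g x * W x * exp (s * W x)) (at 0)" for x
    using deriv[of x s] by (simp add: DERIV_def)
  \<comment> \<open>Restricting to the interval makes \<open>qbound\<close> valid along the whole
    sequence; as the interval is open, the limit is the one at 0.\<close>
  have "((\<lambda>h. ((\<integral>x. g x * exp ((s + h) * W x) \<partial>M) - (\<integral>x. g x * exp (s * W x) \<partial>M)) / h)
      \<longlongrightarrow> (\<integral>x. g x * W x * exp (s * W x) \<partial>M)) (at 0 within {-d<..<d})"
    unfolding tendsto_at_iff_sequentially comp_def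
  proof (intro allI impI)
    fix X :: "nat \<Rightarrow> real"
    assume X: "\<forall>i. X i \<in> {-d<..<d} - {0}" "X \<longlonglongrightarrow> 0"
    have Xi: "\<bar>X i\<bar> < d" "X i \<noteq> 0" for i using X(1)[rule_format, of i] by auto
    have "(\<lambda>i. \<integral>x. ?q (X i) x \<partial>M) \<longlonglongrightarrow> (\<integral>x. g x * W x * exp (s * W x) \<partial>M)"
    proof (rule integral_dominated_convergence[OF _ _ w])
      show "AE x in M. (\<lambda>i. ?q (X i) x) \<longlonglongrightarrow> g x * W x * exp (s * W x)"
        using lim X(2) Xi unfolding tendsto_at_iff_sequentially comp_def by auto
      show "AE x in M. norm (?q (X i) x) \<le> w x" for i
        using qbound[OF Xi] by auto
    qed measurable
    moreover have "(\<integral>x. ?q (X i) x \<partial>M)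
        = ((\<integral>x. g x * exp ((s + X i) * W x) \<partial>M) - (\<integral>x. g x * exp (s * W x) \<partial>M)) / X i" for i
      using int[OF sd[OF Xi(1)]] int[OF s] by (simp only: integral_divide_zero Bochner_Integration.integral_diff)
    ultimately show "(\<lambda>i. ((\<integral>x. g x * exp ((s + X i) * W x) \<partial>M) - (\<integral>x. g x * exp (s * W x) \<partial>M)) / X i)
      \<longlonglongrightarrow> (\<integral>x. g x * W x * exp (s * W x) \<partial>M)" by (simp only:)
  qed
  then show "((\<lambda>s. \<integral>x. g x * exp (s * W x) \<partial>M) has_real_derivative
          (\<integral>x. g x * W x * exp (s * W x) \<partial>M)) (at s)"
    using d by (simp add: DERIV_def at_within_open[of 0 "{-d<..<d}"])
qed

section \<open>Distribution, moment generating function and moments of a Gumbel variable\<close>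

context
  fixes M :: "'a measure" and X :: "'a \<Rightarrow> real" and \<mu> \<beta> :: real
  assumes M: "prob_space M" and X: "gumbel_distributed M X \<mu> \<beta>" and \<beta>: "\<beta> > 0"
begin

interpretation prob_space M by (rule M)

lemma gumbel_measurable [measurable]: "X \<in> borel_measurable M"
  using X by (simp add: gumbel_distributed_def)

lemma gumbel_prob_le: "\<P>(\<omega> in M. X \<omega> \<le> x) = exp (- exp (- (x - \<mu>) / \<beta>))"
proof -
  have "\<P>(\<omega> in M. X \<omega> \<le> x) = cdf (distr M borel X) x"
    by (simp add: cdf_def measure_distr vimage_def Int_def conj_commute)
  then show ?thesis using X by (simp add: gumbel_distributed_def)
qed

text \<open>A continuous distribution function has no atoms; this turns the strict complement of
  \<open>X \<omega> \<le> x\<close> into a closed event.\<close>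

lemma gumbel_prob_eq: "\<P>(\<omega> in M. X \<omega> = x) = 0"
proof -
  interpret D: real_distribution "distr M borel X" by simp
  have "cdf (distr M borel X) = (\<lambda>x. exp (- exp (- (x - \<mu>) / \<beta>)))"
    using X by (auto simp: gumbel_distributed_def)
  then have "isCont (cdf (distr M borel X)) x"
    using \<beta> by (auto intro!: continuous_intros)
  then have "measure (distr M borel X) {x} = 0" by (simp add: D.isCont_cdf)
  then show ?thesis by (simp add: measure_distr vimage_def Int_def conj_commute)
qed

lemma gumbel_prob_ge: "\<P>(\<omega> in M. x \<le> X \<omega>) = 1 - exp (- exp (- (x - \<mu>) / \<beta>))"
proof -
  have "\<P>(\<omega> in M. x \<le> X \<omega>) = \<P>(\<omega> in M. \<not> X \<omega> \<le> x) + \<P>(\<omega> in M. X \<omega> = x)"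
    by (subst finite_measure_Union[symmetric]) (auto intro!: arg_cong[where f = prob])
  also have "\<dots> = 1 - \<P>(\<omega> in M. X \<omega> \<le> x)"
    by (simp add: gumbel_prob_eq prob_neg del: not_le)
  finally show ?thesis by (simp add: gumbel_prob_le)
qed

lemma gumbel_prob_between:
  assumes "a \<le> b"
  shows "\<P>(\<omega> in M. a \<le> X \<omega> \<and> X \<omega> \<le> b)
       = exp (- exp (- (b - \<mu>) / \<beta>)) - exp (- exp (- (a - \<mu>) / \<beta>))"
proof -
  have "\<P>(\<omega> in M. X \<omega> \<le> b) = \<P>(\<omega> in M. a \<le> X \<omega> \<and> X \<omega> \<le> b) + \<P>(\<omega> in M. \<not> a \<le> X \<omega>)"
    using assms by (subst finite_measure_Union[symmetric]) (auto intro!: arg_cong[where f = prob])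
  also have "\<P>(\<omega> in M. \<not> a \<le> X \<omega>) = 1 - \<P>(\<omega> in M. a \<le> X \<omega>)"
    by (rule prob_neg) simp
  finally show ?thesis by (simp add: gumbel_prob_le gumbel_prob_ge)
qed

text \<open>The transformation is decreasing in \<open>X\<close>, so an upper bound on the
  exponential is a lower bound on \<open>X\<close>, and \<open>gumbel_prob_ge\<close> yields
  \<open>1 - exp (- a)\<close>.\<close>

lemma gumbel_exp_exponential:
  "distributed M lborel (\<lambda>\<omega>. exp (- (X \<omega> - \<mu>) / \<beta>)) (exponential_density 1)"
proof (rule exponential_distributedI)
  fix a :: real assume a: "0 \<le> a"
  show "emeasure M {\<omega> \<in> space M. exp (- (X \<omega> - \<mu>) / \<beta>) \<le> a} = 1 - ennreal (exp (- a * 1))"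
  \<comment> \<open>Taking \<open>ln a\<close> needs \<open>a > 0\<close>; at \<open>a = 0\<close>
    the event is empty and the right side vanishes.\<close>
  proof (cases "a = 0")
    case False
    with a have a: "a > 0" by simp
    have "exp (- (x - \<mu>) / \<beta>) \<le> a \<longleftrightarrow> \<mu> - \<beta> * ln a \<le> x" for x
      using \<beta> by (subst ln_ge_iff[OF a, symmetric]) (auto simp: field_simps)
    with \<beta> a show ?thesis
      by (simp add: emeasure_eq_measure gumbel_prob_ge ennreal_minus flip: ennreal_1)
  qed auto
qed simp_all

text \<open>Under the unit exponential law, the moment of order \<open>s\<close> is Euler's integral
  for \<open>Gamma (1 + s)\<close>. Nonnegative integrals give integrability together with the
  value.\<close>

lemma gumbel_mgf:
  assumes "s > -1"
  shows "integrable M (\<lambda>\<omega>. exp (s * (- (X \<omega> - \<mu>) / \<beta>)))" (is "integrable M ?f")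
    and "expectation (\<lambda>\<omega>. exp (s * (- (X \<omega> - \<mu>) / \<beta>))) = Gamma (1 + s)"
proof -
  have "(\<integral>\<^sup>+\<omega>. ?f \<omega> \<partial>M) = (\<integral>\<^sup>+\<omega>. ennreal (exp (- (X \<omega> - \<mu>) / \<beta>) powr s) \<partial>M)"
    by (simp add: powr_def)
  also have "\<dots> = (\<integral>\<^sup>+u. ennreal (exponential_density 1 u) * ennreal (u powr s) \<partial>lborel)"
    by (rule distributed_nn_integral[OF gumbel_exp_exponential, symmetric]) simp
  also have "\<dots> = (\<integral>\<^sup>+u. ennreal (indicator {0..} u * u powr (1 + s - 1) / exp u) \<partial>lborel)"
    by (intro nn_integral_cong)
      (auto simp: exponential_density_def indicator_def exp_minus field_simps ennreal_mult'[symmetric])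
  also have "\<dots> = Gamma (1 + s)"
    using assms by (subst Gamma_conv_nn_integral_real) auto
  finally have *: "(\<integral>\<^sup>+\<omega>. ?f \<omega> \<partial>M) = ennreal (Gamma (1 + s))" .
  have "has_bochner_integral M ?f (Gamma (1 + s))"
    using assms by (intro has_bochner_integral_nn_integral *) (auto intro!: Gamma_real_nonneg)
  then show "integrable M ?f" "expectation ?f = Gamma (1 + s)"
    by (auto simp: has_bochner_integral_iff)
qed

text \<open>The moments are the derivatives of \<open>Gamma (1 + s)\<close> at 0: first
  \<open>Digamma 1\<close>, then \<open>(Digamma 1)^2 + Polygamma 1 1\<close>, where the last term
  is the sum of the inverse squares.\<close>

lemma gumbel_standardized_moments:
  defines "W \<equiv> \<lambda>\<omega>. - (X \<omega> - \<mu>) / \<beta>"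
  shows "integrable M W" "expectation W = - euler_mascheroni"
    "integrable M (\<lambda>\<omega>. (W \<omega>)\<^sup>2)" "expectation (\<lambda>\<omega>. (W \<omega>)\<^sup>2) = euler_mascheroni\<^sup>2 + pi\<^sup>2 / 6"
proof -
  have [measurable]: "W \<in> borel_measurable M" by (simp add: W_def)
  \<comment> \<open>The factor 1 is the weight \<open>g\<close> for the first differentiation;
    \<open>int1\<close> then serves as the hypothesis for the second, with weight
    \<open>W\<close>.\<close>
  have int0: "integrable M (\<lambda>\<omega>. 1 * exp (s * W \<omega>))" if "\<bar>s\<bar> < 1" for s
    using gumbel_mgf(1)[of s] that by (simp add: W_def)
  have mgf: "expectation (\<lambda>\<omega>. exp (s * W \<omega>)) = Gamma (1 + s)" if "\<bar>s\<bar> < 1" for s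
    unfolding W_def using that by (intro gumbel_mgf(2)) auto
  note int1 = integrable_mult_exp_deriv[OF _ _ int0, simplified]
  note int2 = integrable_mult_exp_deriv[OF _ _ int1, simplified]
  have nonpos: "1 + s \<notin> \<int>\<^sub>\<le>\<^sub>0" if "\<bar>s\<bar> < 1" for s :: real
    using that by (auto elim!: nonpos_Ints_cases)
  have 1: "expectation (\<lambda>\<omega>. W \<omega> * exp (s * W \<omega>)) = Gamma (1 + s) * Digamma (1 + s)"
    if s: "\<bar>s\<bar> < 1" for s
  \<comment> \<open>One derivative comes from under the integral, the other from the Gamma function.
    The two functions are known to agree only for \<open>\<bar>s\<bar> < 1\<close>, hence the
    eventual equality.\<close>
  proof (rule DERIV_unique)
    show "((\<lambda>s. expectation (\<lambda>\<omega>. exp (s * W \<omega>))) has_real_derivative expectation (\<lambda>\<omega>. W \<omega> * exp (s * W \<omega>))) (at s)"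
      using has_real_derivative_integral_mult_exp[OF _ _ int0 s] by simp
    have "((\<lambda>s. Gamma (1 + s)) has_real_derivative Gamma (1 + s) * Digamma (1 + s)) (at s)"
      using nonpos[OF s] by (auto intro!: derivative_eq_intros)
    moreover have "\<forall>\<^sub>F s in nhds s. Gamma (1 + s) = expectation (\<lambda>\<omega>. exp (s * W \<omega>))"
      using s by (intro eventually_nhds_in_open[of "{-1<..<1}", THEN eventually_mono])
        (auto simp: mgf)
    ultimately show "((\<lambda>s. expectation (\<lambda>\<omega>. exp (s * W \<omega>))) has_real_derivative
        Gamma (1 + s) * Digamma (1 + s)) (at s)"
      by (subst (asm) DERIV_cong_ev) auto
  qed
  have 2: "expectation (\<lambda>\<omega>. W \<omega> * W \<omega> * exp (0 * W \<omega>))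
      = Gamma 1 * (Digamma 1)\<^sup>2 + Gamma 1 * Polygamma 1 1"
  proof (rule DERIV_unique)
    show "((\<lambda>s. expectation (\<lambda>\<omega>. W \<omega> * exp (s * W \<omega>))) has_real_derivative
        expectation (\<lambda>\<omega>. W \<omega> * W \<omega> * exp (0 * W \<omega>))) (at 0)"
      by (rule has_real_derivative_integral_mult_exp[where g = W and W = W, OF _ _ int1]) auto
    have "((\<lambda>s. Gamma (1 + s) * Digamma (1 + s)) has_real_derivative
        Gamma 1 * (Digamma 1)\<^sup>2 + Gamma 1 * Polygamma 1 1) (at 0)"
      by (rule derivative_eq_intros refl | simp add: power2_eq_square)+
    moreover have "\<forall>\<^sub>F s in nhds 0. Gamma (1 + s) * Digamma (1 + s) = expectation (\<lambda>\<omega>. W \<omega> * exp (s * W \<omega>))"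
      by (intro eventually_nhds_in_open[of "{-1<..<1}", THEN eventually_mono]) (auto simp: 1)
    ultimately show "((\<lambda>s. expectation (\<lambda>\<omega>. W \<omega> * exp (s * W \<omega>))) has_real_derivative
        Gamma 1 * (Digamma 1)\<^sup>2 + Gamma 1 * Polygamma 1 1) (at 0)"
      by (subst (asm) DERIV_cong_ev) auto
  qed
  have "Polygamma 1 (1 :: real) = (\<Sum>k. 1 / (real k + 1)\<^sup>2)"
    by (simp add: Polygamma_def inverse_eq_divide numeral_2_eq_2 add.commute)
  also have "\<dots> = pi\<^sup>2 / 6"
    using inverse_squares_sums by (simp add: sums_iff add.commute)
  finally have "Polygamma 1 (1 :: real) = pi\<^sup>2 / 6" .
  with 2 show "expectation (\<lambda>\<omega>. (W \<omega>)\<^sup>2) = euler_mascheroni\<^sup>2 + pi\<^sup>2 / 6"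
    by (simp add: power2_eq_square)
  show "expectation W = - euler_mascheroni" using 1[of 0] by simp
  show "integrable M W" using int1[where s = 0] by simp
  show "integrable M (\<lambda>\<omega>. (W \<omega>)\<^sup>2)" using int2[where s = 0] by (simp add: power2_eq_square)
qed

text \<open>Both follow from \<open>X = \<mu> - \<beta> * W\<close>; the squared mean cancels in the
  variance of \<open>W\<close>.\<close>

lemma gumbel_expectation: "expectation X = \<mu> + \<beta> * euler_mascheroni"
  and gumbel_variance: "variance X = \<beta>\<^sup>2 * (pi\<^sup>2 / 6)"
proof -
  define W where "W = (\<lambda>\<omega>. - (X \<omega> - \<mu>) / \<beta>)"
  have X_W: "X \<omega> = \<mu> - \<beta> * W \<omega>" for \<omega> using \<beta> by (simp add: W_def)
  have W: "integrable M W" "expectation W = - euler_mascheroni"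
    "integrable M (\<lambda>\<omega>. (W \<omega>)\<^sup>2)" "expectation (\<lambda>\<omega>. (W \<omega>)\<^sup>2) = euler_mascheroni\<^sup>2 + pi\<^sup>2 / 6"
    using gumbel_standardized_moments unfolding W_def by blast+
  show E: "expectation X = \<mu> + \<beta> * euler_mascheroni"
    unfolding X_W using W(1,2) by (simp add: Bochner_Integration.integral_diff prob_space)
  have "variance X = expectation (\<lambda>\<omega>. \<beta>\<^sup>2 * (W \<omega> - expectation W)\<^sup>2)"
    unfolding E by (intro Bochner_Integration.integral_cong) (auto simp: X_W W(2) power2_eq_square algebra_simps)
  also have "\<dots> = \<beta>\<^sup>2 * variance W" by simp
  also have "variance W = pi\<^sup>2 / 6"
    using variance_eq[OF W(1,3)] W by simp
  finally show "variance X = \<beta>\<^sup>2 * (pi\<^sup>2 / 6)" .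
qed

end


section \<open>Rational bounds for the Euler-Mascheroni constant\<close>

text \<open>
  The next Euler-Maclaurin term is \<open>1 / (120 n^4)\<close>; the slack in 90 lets both bounds telescope with
  only two terms of the series for \<open>ln (1 + 1 / n)\<close>.
\<close>

lemma euler_mascheroni_quartic_bounds:
  fixes n :: nat
  assumes n: "n \<ge> 1"
  defines "t \<equiv> harm n - ln (real n) - 1 / (2 * real n) + 1 / (12 * real n ^ 2)"
  shows "euler_mascheroni \<in> {t - 1 / (90 * real n ^ 4)..t}"
proof -
  define T :: "nat \<Rightarrow> real"
    where "T m = harm m - ln (real m) - 1 / (2 * real m) + 1 / (12 * real m ^ 2)" for m
  define R :: "nat \<Rightarrow> real" where "R m = 1 / (90 * real m ^ 4)" for m
  \<comment> \<open>Here \<open>ln (1 + 1 / x)\<close> is twice the inverse hyperbolic tangent of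
    \<open>y\<close>. Two terms of that odd series bound it from below; adding the remainder
    \<open>2 * y ^ 5 / (5 * (1 - y^2))\<close>, rewritten in \<open>x\<close>, bounds it from
    above.\<close>
  have ln_bounds: "ln (1 + 1 / x) \<in> {2 * y + 2 * y ^ 3 / 3..2 * y + 2 * y ^ 3 / 3 + 1 / (10 * x * (x + 1) * (2 * x + 1) ^ 3)}"
    if "x > 0" "y = 1 / (2 * x + 1)" for x y :: real
  proof -
    have "((1 + 1 / x) - 1) / ((1 + 1 / x) + 1) = y" using that by (simp add: field_simps)
    moreover have "2 * (y ^ 5 / (1 - y\<^sup>2) / 5) = 1 / (10 * x * (x + 1) * (2 * x + 1) ^ 3)"
    proof -
      have y1: "1 - y\<^sup>2 = 4 * x * (x + 1) / (2 * x + 1)\<^sup>2"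
        using that(1) unfolding that(2) by (simp add: divide_simps) (simp add: algebra_simps power2_eq_square)
      have "x \<noteq> 0" "x + 1 \<noteq> 0" "2 * x + 1 \<noteq> 0" using that by auto
      then show ?thesis unfolding y1 unfolding that(2) by (simp add: divide_simps)
    qed
    moreover have "(\<Sum>k<2. 2 * y ^ (2 * k + 1) / real (2 * k + 1)) = 2 * y + 2 * y ^ 3 / 3"
      by (simp add: numeral_2_eq_2 numeral_3_eq_3)
    ultimately show ?thesis using ln_approx_bounds[of "1 + 1 / x" 2] that(1) by simp
  qed
  \<comment> \<open>\<open>T\<close> decreases and \<open>T - R\<close> increases towards the common
    limit, which therefore lies between them at every index.\<close>
  have step: "T (Suc m) \<le> T m \<and> T m - R m \<le> T (Suc m) - R (Suc m)" if m: "m \<ge> 1" for m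
  proof -
    define x where "x = real m"
    define y where "y = 1 / (2 * x + 1)"
    have x: "x \<ge> 1" using m by (simp add: x_def)
    have ln_b: "ln (1 + 1 / x) \<in> {2 * y + 2 * y ^ 3 / 3..2 * y + 2 * y ^ 3 / 3 + 1 / (10 * x * (x + 1) * (2 * x + 1) ^ 3)}"
      using x by (intro ln_bounds y_def) simp
    have "ln (1 + 1 / x) = ln (x + 1) - ln x"
      using x ln_div[of "x + 1" x] by (simp add: add_divide_distrib)
    then have D: "T (Suc m) - T m = 1 / (x + 1) - ln (1 + 1 / x) - 1 / (2 * (x + 1))
        + 1 / (12 * (x + 1) ^ 2) + 1 / (2 * x) - 1 / (12 * x ^ 2)"
      using x by (simp add: T_def x_def harm_Suc inverse_eq_divide add_ac)
    have RR: "R m - R (Suc m) = 1 / (90 * x ^ 4) - 1 / (90 * (x + 1) ^ 4)"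
      by (simp add: R_def x_def add_ac)
    have nz: "x \<noteq> 0" "x + 1 \<noteq> 0" "2 * x + 1 \<noteq> 0" using x by auto
    \<comment> \<open>The lower bound for the logarithm bounds the increment of \<open>T\<close>
      from above by a fraction of visible sign.\<close>
    have "1 / (x + 1) - (2 * y + 2 * y ^ 3 / 3) - 1 / (2 * (x + 1))
        + 1 / (12 * (x + 1)\<^sup>2) + 1 / (2 * x) - 1 / (12 * x\<^sup>2)
      = - ((1 + 2 * x + 2 * x\<^sup>2) / (12 * x\<^sup>2 * (x + 1)\<^sup>2 * (2 * x + 1) ^ 3))"
      using nz unfolding y_def by (simp add: divide_simps) algebra
    also have "\<dots> \<le> 0" using x by simp
    finally have c1: "1 / (x + 1) - (2 * y + 2 * y ^ 3 / 3) - 1 / (2 * (x + 1))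
        + 1 / (12 * (x + 1)\<^sup>2) + 1 / (2 * x) - 1 / (12 * x\<^sup>2) \<le> 0" .
    \<comment> \<open>The upper bound for the logarithm bounds the increment of \<open>T - R\<close>
      from below; every coefficient of the numerator is positive.\<close>
    have "0 \<le> (2 + 20 * x + 69 * x ^ 2 + 114 * x ^ 3 + 97 * x ^ 4 + 48 * x ^ 5 + 16 * x ^ 6)
        / (180 * x ^ 4 * (x + 1) ^ 4 * (2 * x + 1) ^ 3)"
      using x by simp
    also have "\<dots> = 1 / (x + 1) - (2 * y + 2 * y ^ 3 / 3 + 1 / (10 * x * (x + 1) * (2 * x + 1) ^ 3))
        - 1 / (2 * (x + 1)) + 1 / (12 * (x + 1)\<^sup>2) + 1 / (2 * x) - 1 / (12 * x\<^sup>2)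
        + (1 / (90 * x ^ 4) - 1 / (90 * (x + 1) ^ 4))"
      using nz unfolding y_def by (simp add: divide_simps) algebra
    finally have c2: "0 \<le> 1 / (x + 1) - (2 * y + 2 * y ^ 3 / 3 + 1 / (10 * x * (x + 1) * (2 * x + 1) ^ 3))
        - 1 / (2 * (x + 1)) + 1 / (12 * (x + 1)\<^sup>2) + 1 / (2 * x) - 1 / (12 * x\<^sup>2)
        + (1 / (90 * x ^ 4) - 1 / (90 * (x + 1) ^ 4))" .
    show ?thesis using c1 c2 ln_b x D RR unfolding atLeastAtMost_iff by linarith
  qed
  have "decseq (\<lambda>k. T (k + n))"
    using step n by (intro decseq_SucI) simp
  moreover have "incseq (\<lambda>k. T (k + n) - R (k + n))"
    using step n by (intro incseq_SucI) simp
  moreover have lim: "T \<longlonglongrightarrow> euler_mascheroni" "R \<longlonglongrightarrow> 0"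
  proof -
    have l: "(\<lambda>m. 1 / (2 * real m)) \<longlonglongrightarrow> 0" "(\<lambda>m. 1 / (12 * real m ^ 2)) \<longlonglongrightarrow> 0"
       "(\<lambda>m. 1 / (90 * real m ^ 4)) \<longlonglongrightarrow> 0"
      by real_asymp+
    show "T \<longlonglongrightarrow> euler_mascheroni" "R \<longlonglongrightarrow> 0"
      using tendsto_add[OF tendsto_diff[OF euler_mascheroni_LIMSEQ l(1)] l(2)] l(3)
      unfolding T_def R_def by simp_all
  qed
  moreover have "(\<lambda>k. T (k + n)) \<longlonglongrightarrow> euler_mascheroni"
    "(\<lambda>k. T (k + n) - R (k + n)) \<longlonglongrightarrow> euler_mascheroni"
    using LIMSEQ_ignore_initial_segment[OF lim(1), of n]
      tendsto_diff[OF LIMSEQ_ignore_initial_segment[OF lim(1), of n] LIMSEQ_ignore_initial_segment[OF lim(2), of n]]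
    by simp_all
  ultimately have "euler_mascheroni \<le> T (0 + n)" "T (0 + n) - R (0 + n) \<le> euler_mascheroni"
    using decseq_ge[of "\<lambda>k. T (k + n)" _ 0] incseq_le[of "\<lambda>k. T (k + n) - R (k + n)" _ 0]
    by blast+
  then show ?thesis by (simp add: t_def T_def R_def)
qed

section \<open>Numerical evaluation of the Gumbel probability\<close>

text \<open>Lagrange remainder, with \<open>exp t \<le> 3\<close> since
  \<open>\<bar>t\<bar> \<le> 1\<close>. The free bound \<open>r\<close> leaves a purely rational
  inequality when the rules meet concrete decimals.\<close>

lemma exp_Taylor_bounds:
  fixes x :: real
  assumes "\<bar>x\<bar> \<le> 1"
  shows exp_ge_Taylor: "r \<le> (\<Sum>k<n. x ^ k / fact k) - 3 * \<bar>x\<bar> ^ n / fact n \<Longrightarrow> r \<le> exp x"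
    and exp_le_Taylor: "(\<Sum>k<n. x ^ k / fact k) + 3 * \<bar>x\<bar> ^ n / fact n \<le> r \<Longrightarrow> exp x \<le> r"
proof -
  obtain t where t: "\<bar>t\<bar> \<le> \<bar>x\<bar>" "exp x = (\<Sum>k<n. x ^ k / fact k) + exp t / fact n * x ^ n"
    using Maclaurin_exp_le[of x n] by auto
  have "exp t \<le> 3"
    using exp_le t(1) assms by (smt (verit) exp_le_cancel_iff)
  then have "exp t * \<bar>x\<bar> ^ n / fact n \<le> 3 * \<bar>x\<bar> ^ n / fact n"
    by (intro divide_right_mono mult_right_mono) auto
  then have "\<bar>exp t / fact n * x ^ n\<bar> \<le> 3 * \<bar>x\<bar> ^ n / fact n"
    by (simp add: abs_mult power_abs)
  then show "r \<le> (\<Sum>k<n. x ^ k / fact k) - 3 * \<bar>x\<bar> ^ n / fact n \<Longrightarrow> r \<le> exp x"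
    "(\<Sum>k<n. x ^ k / fact k) + 3 * \<bar>x\<bar> ^ n / fact n \<le> r \<Longrightarrow> exp x \<le> r"
    unfolding t(2) by linarith+
qed

text \<open>Eight terms of the inverse hyperbolic tangent series at 1/3 leave an error near
  1e-9.\<close>

lemma ln_2_bounds: "ln 2 \<in> {0.693147179 .. 0.693147181 :: real}"
  using ln_approx_bounds[of 2 8] by (simp add: eval_nat_numeral)

text \<open>The index 16 is a power of two, so \<open>ln 2\<close> is the only logarithm to bound;
  the quartic gap \<open>1 / (90 * 16 ^ 4)\<close> is about 1.7e-7.\<close>

lemma euler_mascheroni_approx: "euler_mascheroni \<in> {0.5772155 .. 0.5772158 :: real}"
proof -
  have "ln (16 :: real) = 4 * ln 2" using ln_realpow[of 2 4] by simp
  then show ?thesis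
    using euler_mascheroni_quartic_bounds[of 16] ln_2_bounds by (simp add: harm_expand)
qed

text \<open>
  Each exponential is split at a nearby decimal with at most two digits, so that the Taylor
  sums of the main factors are fractions of moderate size.
\<close>

lemma gumbel_central_value_bounds:
  fixes g s :: real
  assumes g: "g \<in> {0.5772155..0.5772158}" and s: "s \<in> {1.28254982..1.28254984}"
  shows "exp (- exp (- (g + s))) - exp (- exp (s - g)) \<in> {0.723751..0.7237514}"
proof -
  have e1: "0.394553709 \<le> exp (- 0.93 :: real)" "exp (- 0.93 :: real) \<le> 0.394553711"
    by (rule exp_ge_Taylor[where n = 13] exp_le_Taylor[where n = 13]; simp add: eval_nat_numeral)+
  have e2: "2.013752707 \<le> exp (0.7 :: real)" "exp (0.7 :: real) \<le> 2.013752708"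
    by (rule exp_ge_Taylor[where n = 13] exp_le_Taylor[where n = 13]; simp add: eval_nat_numeral)+
  have e3: "0.852143788 \<le> exp (- 0.16 :: real)" "exp (- 0.16 :: real) \<le> 0.85214379"
    by (rule exp_ge_Taylor[where n = 9] exp_le_Taylor[where n = 9]; simp add: eval_nat_numeral)+
  have e4: "0.606530659 \<le> exp (- 0.5 :: real)" "exp (- 0.5 :: real) \<le> 0.60653066"
    by (rule exp_ge_Taylor[where n = 13] exp_le_Taylor[where n = 13]; simp add: eval_nat_numeral)+
  \<comment> \<open>The arguments in \<open>d1\<close> and \<open>d2\<close> are the extreme values
    of \<open>1.86 - (g + s)\<close> and \<open>s - g - 0.7\<close> over the given intervals; those
    in \<open>d3\<close> and \<open>d4\<close> come from the resulting bounds \<open>a_lo\<close>,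
    \<open>a_hi\<close>, \<open>b_lo\<close> and \<open>b_hi\<close>.\<close>
  have d1: "1.000234387 \<le> exp (0.00023436 :: real)" "exp (0.00023468 :: real) \<le> 1.000234708"
    by (rule exp_ge_Taylor[where n = 4] exp_le_Taylor[where n = 4]; simp add: eval_nat_numeral)+
  have d2: "1.005348271 \<le> exp (0.00533402 :: real)" "exp (0.00533434 :: real) \<le> 1.005348594"
    by (rule exp_ge_Taylor[where n = 5] exp_le_Taylor[where n = 5]; simp add: eval_nat_numeral)+
  have d3: "1.004300048 \<le> exp (0.00429083 :: real)" "exp (0.00429089 :: real) \<le> 1.00430011"
    by (rule exp_ge_Taylor[where n = 5] exp_le_Taylor[where n = 5]; simp add: eval_nat_numeral)+
  have d4: "0.975774757 \<le> exp (- 0.0245235 :: real)" "exp (- 0.0245228 :: real) \<le> 0.975775442"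
    by (rule exp_ge_Taylor[where n = 6] exp_le_Taylor[where n = 6]; simp add: eval_nat_numeral)+
  \<comment> \<open>The Taylor bounds ask for arguments of absolute value at most 1, so 1.86 is
    reached as 2 * 0.93, and 2 in \<open>d\<close> as 4 * 0.5.\<close>
  have a: "exp (- (g + s)) = exp (- 0.93) ^ 2 * exp (1.86 - (g + s))"
    by (simp flip: exp_of_nat_mult exp_add)
  have b: "exp (s - g) = exp 0.7 * exp (s - g - 0.7)"
    by (simp flip: exp_add)
  have "1.000234387 \<le> exp (1.86 - (g + s))"
    using g s by (intro order_trans[OF d1(1)]) simp
  then have "0.394553709 ^ 2 * 1.000234387 \<le> exp (- (g + s))"
    unfolding a using e1 by (intro mult_mono power_mono) auto
  then have a_lo: "0.15570911 \<le> exp (- (g + s))" by (simp add: power2_eq_square)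
  have "exp (1.86 - (g + s)) \<le> 1.000234708"
    using g s by (intro order_trans[OF _ d1(2)]) simp
  then have "exp (- (g + s)) \<le> 0.394553711 ^ 2 * 1.000234708"
    unfolding a using e1 by (intro mult_mono power_mono) auto
  then have a_hi: "exp (- (g + s)) \<le> 0.15570917" by (simp add: power2_eq_square)
  have "1.005348271 \<le> exp (s - g - 0.7)"
    using g s by (intro order_trans[OF d2(1)]) simp
  then have "2.013752707 * 1.005348271 \<le> exp (s - g)"
    unfolding b using e2 by (intro mult_mono) auto
  then have b_lo: "2.0245228 \<le> exp (s - g)" by simp
  have "exp (s - g - 0.7) \<le> 1.005348594"
    using g s by (intro order_trans[OF _ d2(2)]) simp
  then have "exp (s - g) \<le> 2.013752708 * 1.005348594"
    unfolding b using e2 by (intro mult_mono) auto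
  then have b_hi: "exp (s - g) \<le> 2.0245235" by simp
  have c: "exp (- x) = exp (- 0.16) * exp (0.16 - x)" for x :: real
    by (simp flip: exp_add)
  have d: "exp (- x) = exp (- 0.5) ^ 4 * exp (2 - x)" for x :: real
    by (simp flip: exp_of_nat_mult exp_add)
  have "1.004300048 \<le> exp (0.16 - exp (- (g + s)))"
    using a_hi by (intro order_trans[OF d3(1)]) simp
  then have "0.852143788 * 1.004300048 \<le> exp (- exp (- (g + s)))"
    unfolding c[of "exp (- (g + s))"] using e3 by (intro mult_mono) auto
  moreover have "exp (0.16 - exp (- (g + s))) \<le> 1.00430011"
    using a_lo by (intro order_trans[OF _ d3(2)]) simp
  then have "exp (- exp (- (g + s))) \<le> 0.85214379 * 1.00430011"
    unfolding c[of "exp (- (g + s))"] using e3 by (intro mult_mono) auto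
  moreover have "0.975774757 \<le> exp (2 - exp (s - g))"
    using b_hi by (intro order_trans[OF d4(1)]) simp
  then have "0.606530659 ^ 4 * 0.975774757 \<le> exp (- exp (s - g))"
    unfolding d[of "exp (s - g)"] using e4 by (intro mult_mono power_mono) auto
  moreover have "exp (2 - exp (s - g)) \<le> 0.975775442"
    using b_lo by (intro order_trans[OF _ d4(2)]) simp
  then have "exp (- exp (s - g)) \<le> 0.60653066 ^ 4 * 0.975775442"
    unfolding d[of "exp (s - g)"] using e4 by (intro mult_mono power_mono) auto
  ultimately show ?thesis by (simp add: power4_eq_xxxx)
qed

section \<open>Rounding, and the normal probability of one standard deviation\<close>

lemma rounds_toI:
  assumes "\<bar>x * 10 ^ d - of_int n\<bar> < 1 / 2" "a = of_int n / 10 ^ d"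
  shows "rounds_to d x a"
  using assms by (simp add: rounds_to_def round_unique')

text \<open>The density is integrated through a Taylor polynomial with explicit antiderivative; both
  ends of the interval round to 0.6827.\<close>

lemma normal_prob_one_sigma:
  fixes N :: "'b measure"
  assumes "prob_space N" and Z: "distributed N lborel Z std_normal_density"
  shows "\<P>(\<omega> in N. \<bar>Z \<omega>\<bar> \<le> 1) \<in> {0.68268 .. 0.6827}"
proof -
  interpret prob_space N by fact
  have [measurable]: "Z \<in> borel_measurable N" using Z by (simp add: distributed_def)
  \<comment> \<open>\<open>p\<close> is a Taylor polynomial of \<open>exp (- (x^2 / 2))\<close>,
    \<open>F\<close> its odd antiderivative, and \<open>c\<close> a uniform error on [-1, 1], where
    the remainder is at most \<open>3 * (1 / 2) ^ 8 / fact 8\<close>, below 3e-7.\<close>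
  define p where "p = (\<lambda>x :: real. \<Sum>k<8. (- (x\<^sup>2 / 2)) ^ k / fact k)"
  define F where "F = (\<lambda>x :: real. \<Sum>k<8. (- 1 / 2) ^ k * x ^ (2 * k + 1) / (fact k * (2 * real k + 1)))"
  define c :: real where "c = 1 / 10 ^ 6"
  define J where "J = (\<integral>x. exp (- ((x::real)\<^sup>2 / 2)) * indicator {-1..1} x \<partial>lborel)"
  have "\<P>(\<omega> in N. \<bar>Z \<omega>\<bar> \<le> 1) = (\<integral>\<omega>. indicator {\<omega> \<in> space N. \<bar>Z \<omega>\<bar> \<le> 1} \<omega> \<partial>N)"
    by simp
  also have "\<dots> = (\<integral>\<omega>. indicator {-1..1} (Z \<omega>) \<partial>N)"
    by (intro Bochner_Integration.integral_cong) (auto simp: indicator_def abs_le_iff)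
  also have "\<dots> = (\<integral>x. std_normal_density x * indicator {-1..1} x \<partial>lborel)"
    by (rule distributed_integral[OF Z, symmetric]) auto
  also have "\<dots> = J / sqrt (2 * pi)"
    by (simp add: J_def std_normal_density_def)
  finally have P: "\<P>(\<omega> in N. \<bar>Z \<omega>\<bar> \<le> 1) = J / sqrt (2 * pi)" .
  have F: "(F has_real_derivative p x) (at x)" for x
    unfolding F_def p_def
  proof (rule DERIV_sum)
    fix k :: nat
    have "2 * real k + 1 \<noteq> 0" by linarith
    moreover have "(- (x\<^sup>2 / 2)) ^ k = (- 1 / 2) ^ k * x ^ (2 * k)"
      using power_mult_distrib[of "- 1 / 2" "x\<^sup>2" k] by (simp add: power_mult)
    ultimately have "(- 1 / 2) ^ k * ((2 * real k + 1) * x ^ (2 * k)) / (fact k * (2 * real k + 1))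
        = (- (x\<^sup>2 / 2)) ^ k / fact k"
      by simp
    moreover have "((\<lambda>x. (- 1 / 2) ^ k * x ^ (2 * k + 1) / (fact k * (2 * real k + 1))) has_real_derivative
        (- 1 / 2) ^ k * ((2 * real k + 1) * x ^ (2 * k)) / (fact k * (2 * real k + 1))) (at x)"
      by (intro DERIV_cdivide DERIV_cmult DERIV_cong[OF DERIV_pow]) simp
    ultimately show "((\<lambda>x. (- 1 / 2) ^ k * x ^ (2 * k + 1) / (fact k * (2 * real k + 1)))
        has_real_derivative (- (x\<^sup>2 / 2)) ^ k / fact k) (at x)"
      by simp
  qed
  \<comment> \<open>Taking \<open>e\<close> as \<open>c\<close> and as \<open>- c\<close> gives the
    upper and the lower comparison integral.\<close>
  have int_p: "has_bochner_integral lborel (\<lambda>x. (p x + e) * indicator {-1..1} x) (F 1 - F (-1) + 2 * e)" for e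
  proof -
    have "has_bochner_integral lborel (\<lambda>x. (p x + e) * indicator {-1..1} x)
        ((F 1 + e * 1) - (F (-1) + e * (-1)))"
      using F by (intro has_bochner_integral_FTC_Icc_real)
        (auto intro!: derivative_eq_intros continuous_intros simp: p_def)
    then show ?thesis by (simp add: algebra_simps)
  qed
  have J: "integrable lborel (\<lambda>x :: real. exp (- (x\<^sup>2 / 2)) * indicator {-1..1} x)"
    using borel_integrable_compact[of "{-1..1::real}" "\<lambda>x. exp (- (x\<^sup>2 / 2))"]
    by (simp add: mult.commute continuous_intros)
  have approx: "p x - c \<le> exp (- (x\<^sup>2 / 2)) \<and> exp (- (x\<^sup>2 / 2)) \<le> p x + c" if "\<bar>x\<bar> \<le> 1" for x
  proof -
    have x: "x\<^sup>2 / 2 \<le> 1 / 2" using that by (simp add: abs_square_le_1)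
    have "3 * \<bar>- (x\<^sup>2 / 2)\<bar> ^ 8 / fact 8 \<le> 3 * (1 / 2) ^ 8 / fact 8"
      using x by (intro divide_right_mono mult_left_mono power_mono) auto
    also have "\<dots> \<le> c" by (simp add: c_def fact_numeral power_divide)
    finally show ?thesis using exp_Taylor_bounds[of "- (x\<^sup>2 / 2)", where n = 8] x unfolding p_def by force
  qed
  have "J \<le> (\<integral>x. (p x + c) * indicator {-1..1} x \<partial>lborel)"
    unfolding J_def using int_p[of c] J approx
    by (intro integral_mono) (auto simp: has_bochner_integral_iff indicator_def abs_le_iff)
  also have "\<dots> = F 1 - F (-1) + 2 * c"
    using int_p[of c] by (simp add: has_bochner_integral_iff)
  finally have J_le: "J \<le> F 1 - F (-1) + 2 * c" .
  have "F 1 - F (-1) + 2 * (- c) = (\<integral>x. (p x + (- c)) * indicator {-1..1} x \<partial>lborel)"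
    using int_p[of "- c"] by (simp add: has_bochner_integral_iff)
  also have "\<dots> \<le> J"
    unfolding J_def using int_p[of "- c"] J approx
    by (intro integral_mono) (auto simp: has_bochner_integral_iff indicator_def abs_le_iff)
  finally have J_ge: "F 1 - F (-1) - 2 * c \<le> J" by simp
  have FF: "F 1 - F (-1) \<in> {1.71124 .. 1.71125}"
    by (simp add: F_def eval_nat_numeral)
  have "sqrt (2 * pi) \<le> 2.506629" "2.506628 \<le> sqrt (2 * pi)"
    using pi_approx by (intro real_le_lsqrt real_le_rsqrt; simp add: power2_eq_square)+
  with FF J_le J_ge show ?thesis
    unfolding P by (auto simp: c_def pos_divide_le_eq pos_le_divide_eq)
qed

theorem theorem2p2:
  fixes M :: "'a measure" and X :: "'a \<Rightarrow> real"
    and N :: "'b measure" and Z :: "'b \<Rightarrow> real"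
    and \<mu> \<beta> :: real
  assumes "\<beta> > 0"
    and "prob_space M" and "gumbel_distributed M X \<mu> \<beta>"
    and "prob_space N" and "distributed N lborel Z std_normal_density"
  shows "rounds_to 6
           \<P>(\<omega> in M. \<bar>X \<omega> - prob_space.expectation M X\<bar> \<le> sqrt (prob_space.variance M X)) 0.723751
       \<and> 0.723751 > \<P>(\<omega> in N. \<bar>Z \<omega>\<bar> \<le> 1)
       \<and> \<P>(\<omega> in M. \<bar>X \<omega> - prob_space.expectation M X\<bar> \<le> sqrt (prob_space.variance M X))
           > \<P>(\<omega> in N. \<bar>Z \<omega>\<bar> \<le> 1)
       \<and> rounds_to 4 \<P>(\<omega> in N. \<bar>Z \<omega>\<bar> \<le> 1) 0.6827"
proof -
  \<comment> \<open>The standard deviation in units of \<open>\<beta>\<close>.\<close>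
  define s where "s = sqrt (pi\<^sup>2 / 6)"
  interpret M: prob_space M by fact
  let ?P = "\<P>(\<omega> in M. \<bar>X \<omega> - M.expectation X\<bar> \<le> sqrt (M.variance X))"
  let ?Q = "\<P>(\<omega> in N. \<bar>Z \<omega>\<bar> \<le> 1)"
  note gumbel = assms(2,3,1)
  have E: "M.expectation X = \<mu> + \<beta> * euler_mascheroni"
    by (rule gumbel_expectation[OF gumbel])
  have V: "sqrt (M.variance X) = \<beta> * s"
    unfolding gumbel_variance[OF gumbel] s_def using assms(1) by (simp only: real_sqrt_mult) simp
  have s: "s \<in> {1.28254982..1.28254984}"
  proof -
    have "3.141592653588\<^sup>2 \<le> pi\<^sup>2" "pi\<^sup>2 \<le> 3.1415926535899\<^sup>2"
      using pi_approx by (intro power_mono; simp)+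
    then show ?thesis
      unfolding s_def atLeastAtMost_iff
      by (intro conjI real_le_lsqrt real_le_rsqrt; simp add: power2_eq_square)
  qed
  have "?P = \<P>(\<omega> in M. \<mu> + \<beta> * euler_mascheroni - \<beta> * s \<le> X \<omega>
      \<and> X \<omega> \<le> \<mu> + \<beta> * euler_mascheroni + \<beta> * s)"
    unfolding V unfolding E by (intro arg_cong[where f = "measure M"] Collect_cong) auto
  also have "\<dots> = exp (- exp (- (\<mu> + \<beta> * euler_mascheroni + \<beta> * s - \<mu>) / \<beta>))
      - exp (- exp (- (\<mu> + \<beta> * euler_mascheroni - \<beta> * s - \<mu>) / \<beta>))"
  proof (rule gumbel_prob_between[OF gumbel])
    have "0 \<le> \<beta> * s" using assms(1) s by simp
    then show "\<mu> + \<beta> * euler_mascheroni - \<beta> * s \<le> \<mu> + \<beta> * euler_mascheroni + \<beta> * s"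
      by simp
  qed
  also have "- (\<mu> + \<beta> * euler_mascheroni + \<beta> * s - \<mu>) / \<beta> = - (euler_mascheroni + s)"
    using assms(1) by (simp add: field_simps)
  also have "- (\<mu> + \<beta> * euler_mascheroni - \<beta> * s - \<mu>) / \<beta> = s - euler_mascheroni"
    using assms(1) by (simp add: field_simps)
  finally have P: "?P \<in> {0.723751..0.7237514}"
    using gumbel_central_value_bounds[OF euler_mascheroni_approx s] by simp
  have Q: "?Q \<in> {0.68268..0.6827}"
    by (rule normal_prob_one_sigma) fact+
  have "rounds_to 6 ?P 0.723751"
    \<comment> \<open>Scaled by 10^6, \<open>?P\<close> lies within 0.4 of 723751; likewise
      \<open>?Q\<close>, scaled by 10^4, lies within 0.2 of 6827.\<close>
    using P by (intro rounds_toI[where n = 723751]) (auto simp: abs_less_iff)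
  moreover have "rounds_to 4 ?Q 0.6827"
    using Q by (intro rounds_toI[where n = 6827]) (auto simp: abs_less_iff)
  ultimately show ?thesis using P Q by auto
qed

end
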